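(* Let $T$ be an infinite rooted tree, let $0<p\le\infty$, let $\psi:T\to\mathbb{C}$, let $M_\psi:\mathbb{T}_p\to\mathbb{T}_p$ be a bounded multiplication operator and let $E=\{v\in T:\psi(v)\neq1\}$. Then the collection of all fixed points of $M_\psi$ (that is, of all $f\in\mathbb{T}_p$ with $M_\psi f=f$) is precisely the closed subspace $\{f\in\mathbb{T}_p: f|_E=0\}$ of $\mathbb{T}_p$.
   Context: Let $T$ be an infinite rooted tree with root $o$; $T$ also denotes its vertex set. For a vertex $v$, $|v|$ is the number of edges in the unique path from $o$ to $v$. For $n\in\mathbb{N}_0=\{0,1,2,\dots\}$, $D_n=\{v\in T:|v|=n\}$, and $c_n$ is the number of elements of $D_n$, assumed finite for each $n$ (so $1\le c_n<\infty$). For $f:T\to\mathbb{C}$ and $0<p<\infty$ put $M_p(n,f)=\left(\frac1{c_n}\sum_{|v|=n}|f(v)|^p\right)^{1/p}$, and $M_\infty(n,f)=\max_{|v|=n}|f(v)|$. For $0<p\le\infty$ put $\|f\|_p=\sup_{n\in\mathbb{N}_0}M_p(n,f)$ and $\mathbb{T}_p=\{f:T\to\mathbb{C}:\|f\|_p<\infty\}$; closedness in $\mathbb{T}_p$ is with respect to $\|\cdot\|_p$-convergence. For $\psi:T\to\mathbb{C}$, $M_\psi f=\psi f$ (pointwise product). $M_\psi:\mathbb{T}_p\to\mathbb{T}_p$ is bounded if it maps $\mathbb{T}_p$ into itself and $\sup\{\|\psi f\|_p/\|f\|_p: f\in\mathbb{T}_p, f\neq0\}<\infty$. *)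

theory Defs
  imports "HOL-Analysis.Analysis" "HOL-Library.Function_Algebras"
begin

text \<open>
  A graph is given by its adjacency relation; its vertex set is the whole type. Paths are
  recorded by their (pairwise distinct) vertices, so a path has one edge fewer than vertices.
\<close>

definition is_path :: "('v \<Rightarrow> 'v \<Rightarrow> bool) \<Rightarrow> 'v \<Rightarrow> 'v \<Rightarrow> 'v list \<Rightarrow> bool" where
  "is_path adj u v xs \<longleftrightarrow>
     xs \<noteq> [] \<and> hd xs = u \<and> last xs = v \<and> distinct xs \<and> successively adj xs"

definition is_cycle :: "('v \<Rightarrow> 'v \<Rightarrow> bool) \<Rightarrow> 'v list \<Rightarrow> bool" where
  "is_cycle adj xs \<longleftrightarrow>
     3 \<le> length xs \<and> distinct xs \<and> successively adj xs \<and> adj (last xs) (hd xs)"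

definition is_tree :: "('v \<Rightarrow> 'v \<Rightarrow> bool) \<Rightarrow> bool" where
  "is_tree adj \<longleftrightarrow> symp adj \<and> irreflp adj \<and>
     (\<forall>u v. \<exists>xs. is_path adj u v xs) \<and> (\<nexists>xs. is_cycle adj xs)"

lemma is_tree_unique_path:
  assumes "is_tree adj"
  shows "\<exists>!xs. is_path adj u v xs"
proof -
  have sym: "symp adj" and acyc: "\<And>xs. \<not> is_cycle adj xs"
    and conn: "\<exists>xs. is_path adj u v xs"
    using assms by (auto simp: is_tree_def)
  have "xs = ys" if "is_path adj u v xs" "is_path adj u v ys" for xs ys
    using that
  proof (induction xs arbitrary: u ys)
    case Nil
    then show ?case by (simp add: is_path_def)
  next
    case (Cons x xs)
    then obtain ys' where ys: "ys = u # ys'" and x: "x = u"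
      by (cases ys) (auto simp: is_path_def)
    show ?case
    proof (cases "xs = [] \<or> ys' = []")
      case True
      then show ?thesis
        using Cons.prems unfolding ys x is_path_def
        by (metis distinct.simps(2) last.simps last_in_set)
    next
      case False
      then have ne: "xs \<noteq> []" "ys' \<noteq> []" by auto
      have px: "is_path adj (hd xs) v xs" "adj u (hd xs)" "u \<notin> set xs"
        and py: "is_path adj (hd ys') v ys'" "adj u (hd ys')" "u \<notin> set ys'"
        using Cons.prems ne unfolding ys x is_path_def
        by (auto simp: successively_Cons)
      show ?thesis
      proof (cases "hd xs = hd ys'")
        case True
        then show ?thesis using Cons.IH px py ys x by metis
      next
        case neq: False
        have "\<exists>z\<in>set xs. z \<in> set ys'"
          using px py ne by (metis is_path_def last_in_set)
        then obtain A z C where A: "xs = A @ z # C" "z \<in> set ys'" "\<forall>a\<in>set A. a \<notin> set ys'"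
          using split_list_first_prop[of xs "\<lambda>z. z \<in> set ys'"] by blast
        obtain B D where B: "ys' = B @ z # D"
          using A(2) by (meson split_list)
        have nAB: "A \<noteq> [] \<or> B \<noteq> []" using neq A B by auto
        have sA: "successively adj (u # A @ [z])"
          using px(1,2) A(1) by (auto simp: is_path_def successively_append_iff successively_Cons hd_append)
        have sB: "successively adj (u # B @ [z])"
          using py(1,2) B by (auto simp: is_path_def successively_append_iff successively_Cons hd_append)
        then have "successively adj (rev (u # B @ [z]))"
          using sym by (simp only: successively_rev) (metis (mono_tags) successively_mono sympD)
        then have sB': "successively adj (z # rev B @ [u])" by simp
        have "is_cycle adj (u # A @ z # rev B)"
          unfolding is_cycle_def
        proof (intro conjI)
          show "3 \<le> length (u # A @ z # rev B)"
            using nAB by (cases A; cases B) auto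
          show "distinct (u # A @ z # rev B)"
            using px py A B by (auto simp: is_path_def)
          show "successively adj (u # A @ z # rev B)"
            using sA sB' by (auto simp: successively_append_iff successively_Cons hd_append split: if_splits)
          show "adj (last (u # A @ z # rev B)) (hd (u # A @ z # rev B))"
            using sB' by (auto simp: successively_append_iff successively_Cons split: if_splits)
        qed
        then show ?thesis using acyc by blast
      qed
    qed
  qed
  then show ?thesis using conn by blast
qed

definition depth :: "('v \<Rightarrow> 'v \<Rightarrow> bool) \<Rightarrow> 'v \<Rightarrow> 'v \<Rightarrow> nat" where
  "depth adj r v = length (THE xs. is_path adj r v xs) - 1"

definition level :: "('v \<Rightarrow> 'v \<Rightarrow> bool) \<Rightarrow> 'v \<Rightarrow> nat \<Rightarrow> 'v set" where
  "level adj r n = {v. depth adj r v = n}"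

definition Mean :: "('v \<Rightarrow> 'v \<Rightarrow> bool) \<Rightarrow> 'v \<Rightarrow> ennreal \<Rightarrow> nat \<Rightarrow> ('v \<Rightarrow> complex) \<Rightarrow> real" where
  "Mean adj r p n f =
     (if p = \<infinity> then Max ((\<lambda>v. cmod (f v)) ` level adj r n)
      else ((1 / real (card (level adj r n))) *
            (\<Sum>v\<in>level adj r n. cmod (f v) powr enn2real p)) powr (1 / enn2real p))"

text \<open>The supremum is taken in the extended nonnegative reals, so it is \<open>\<infinity>\<close> for unbounded means.\<close>

definition Tnorm :: "('v \<Rightarrow> 'v \<Rightarrow> bool) \<Rightarrow> 'v \<Rightarrow> ennreal \<Rightarrow> ('v \<Rightarrow> complex) \<Rightarrow> ennreal" where
  "Tnorm adj r p f = (SUP n. ennreal (Mean adj r p n f))"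

definition Tspace :: "('v \<Rightarrow> 'v \<Rightarrow> bool) \<Rightarrow> 'v \<Rightarrow> ennreal \<Rightarrow> ('v \<Rightarrow> complex) set" where
  "Tspace adj r p = {f. Tnorm adj r p f < \<infinity>}"

definition mult_op :: "('v \<Rightarrow> complex) \<Rightarrow> ('v \<Rightarrow> complex) \<Rightarrow> ('v \<Rightarrow> complex)" where
  "mult_op \<psi> f = (\<lambda>v. \<psi> v * f v)"

definition bounded_op ::
  "('v \<Rightarrow> 'v \<Rightarrow> bool) \<Rightarrow> 'v \<Rightarrow> ennreal \<Rightarrow> (('v \<Rightarrow> complex) \<Rightarrow> ('v \<Rightarrow> complex)) \<Rightarrow> bool" where
  "bounded_op adj r p A \<longleftrightarrow>
     A ` Tspace adj r p \<subseteq> Tspace adj r p \<and>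
     (SUP f \<in> {f \<in> Tspace adj r p. f \<noteq> 0}. Tnorm adj r p (A f) / Tnorm adj r p f) < \<infinity>"

interpretation cfun: vector_space "\<lambda>(c::complex) (f :: 'v \<Rightarrow> complex) v. c * f v"
  by unfold_locales (auto simp: fun_eq_iff algebra_simps)

text \<open>
  For \<open>p < 1\<close> the functional \<open>Tnorm\<close> is only a quasi-norm, so closedness is expressed by
  sequential convergence.
\<close>

definition closed_in_Tspace ::
  "('v \<Rightarrow> 'v \<Rightarrow> bool) \<Rightarrow> 'v \<Rightarrow> ennreal \<Rightarrow> ('v \<Rightarrow> complex) set \<Rightarrow> bool" where
  "closed_in_Tspace adj r p S \<longleftrightarrow>
     (\<forall>F f. (\<forall>k. F k \<in> S) \<and> f \<in> Tspace adj r p \<and>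
        (\<lambda>k. Tnorm adj r p (F k - f)) \<longlonglongrightarrow> 0 \<longrightarrow> f \<in> S)"

definition closed_subspace ::
  "('v \<Rightarrow> 'v \<Rightarrow> bool) \<Rightarrow> 'v \<Rightarrow> ennreal \<Rightarrow> ('v \<Rightarrow> complex) set \<Rightarrow> bool" where
  "closed_subspace adj r p S \<longleftrightarrow>
     S \<subseteq> Tspace adj r p \<and> cfun.subspace S \<and> closed_in_Tspace adj r p S"

end

theory Submission
  imports Defs
begin

text \<open>
  For the fixed points, \<open>\<psi> v * f v = f v\<close> holds iff \<open>\<psi> v = 1\<close> or \<open>f v = 0\<close>. The set is a
  subspace because the means satisfy a quasi-triangle inequality with a constant that depends
  only on \<open>p\<close>, and it is closed because each value \<open>f v\<close> is controlled by the mean over the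
  finite level containing \<open>v\<close>, so that convergence in norm implies pointwise convergence.
\<close>

lemma mult_op_fixed_iff: "mult_op \<psi> f = f \<longleftrightarrow> (\<forall>v\<in>{v. \<psi> v \<noteq> 1}. f v = 0)"
  by (auto simp: mult_op_def fun_eq_iff)

text \<open>
  The comparisons use \<open>ennreal (Mean \<dots>)\<close> and constants that are at least 1, so that they also
  hold for empty levels, where the mean for \<open>p = \<infinity>\<close> is the unspecified value \<open>Max {}\<close>.
\<close>

lemma Mean_mono:
  assumes fin: "finite (level adj r n)" and p: "0 < p" and K: "1 \<le> K"
    and le: "\<And>v. cmod (f v) \<le> K * cmod (g v)"
  shows "ennreal (Mean adj r p n f) \<le> ennreal K * ennreal (Mean adj r p n g)"
proof (cases "p = \<infinity>")
  case True
  show ?thesis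
  proof (cases "level adj r n = {}")
    case empty: True
    have "1 * ennreal (Max {}) \<le> ennreal K * ennreal (Max {})"
      using K by (intro mult_right_mono) auto
    then show ?thesis using True empty by (simp add: Mean_def)
  next
    case False
    have "Max ((\<lambda>v. cmod (f v)) ` level adj r n) \<le> K * Max ((\<lambda>v. cmod (g v)) ` level adj r n)"
    proof (intro Max.boundedI)
      fix x assume "x \<in> (\<lambda>v. cmod (f v)) ` level adj r n"
      then obtain v where v: "v \<in> level adj r n" "x = cmod (f v)" by auto
      have "cmod (g v) \<le> Max ((\<lambda>v. cmod (g v)) ` level adj r n)"
        using v fin by (intro Max_ge) auto
      then show "x \<le> K * Max ((\<lambda>v. cmod (g v)) ` level adj r n)"
        using le[of v] v(2) K by (smt (verit) mult_left_mono)
    qed (use fin False in auto)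
    then show ?thesis
      using True K by (simp add: Mean_def ennreal_leI flip: ennreal_mult')
  qed
next
  case False
  define q where "q = enn2real p"
  have q: "0 < q"
    using p False by (simp add: q_def enn2real_positive_iff top.not_eq_extremum)
  define A where "A h = 1 / real (card (level adj r n)) * (\<Sum>v\<in>level adj r n. cmod (h v) powr q)"
    for h :: "'a \<Rightarrow> complex"
  have A0: "0 \<le> A h" for h by (simp add: A_def sum_nonneg)
  have M: "Mean adj r p n h = A h powr (1 / q)" for h
    using False by (simp add: Mean_def A_def q_def)
  have "A f \<le> 1 / real (card (level adj r n)) * (\<Sum>v\<in>level adj r n. K powr q * cmod (g v) powr q)"
    unfolding A_def
  proof (intro mult_left_mono sum_mono)
    fix v
    have "cmod (f v) powr q \<le> (K * cmod (g v)) powr q"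
      using q le by (intro powr_mono2) auto
    then show "cmod (f v) powr q \<le> K powr q * cmod (g v) powr q"
      using K by (simp add: powr_mult)
  qed auto
  then have "A f \<le> K powr q * A g"
    by (simp add: A_def sum_distrib_left)
  \<comment> \<open>Since \<open>q\<close> is positive, the outer power \<open>1 / q\<close> is
    monotone and turns the factor \<open>K powr q\<close> back into \<open>K\<close>.\<close>
  then have "A f powr (1 / q) \<le> (K powr q * A g) powr (1 / q)"
    using q A0 by (intro powr_mono2) auto
  also have "\<dots> = K * A g powr (1 / q)"
    using q K A0 by (simp add: powr_mult powr_powr)
  finally show ?thesis
    using K by (simp add: M ennreal_leI flip: ennreal_mult')
qed

text \<open>Passing through the pointwise maximum of the two moduli replaces Minkowski's inequality,
  which fails for exponents below 1, and so treats all \<open>p\<close> alike. The constant is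
  chosen before the level, so the estimate survives the supremum over levels.\<close>

lemma Mean_quasi_triangle:
  assumes "0 < p"
  obtains K where "\<And>n f g. finite (level adj r n) \<Longrightarrow> ennreal (Mean adj r p n (f + g))
           \<le> ennreal K * (ennreal (Mean adj r p n f) + ennreal (Mean adj r p n g))"
proof
  define q where "q = enn2real p"
  \<comment> \<open>The first 2 comes from bounding a sum of two moduli by twice their maximum, the
    second from the same bound applied to the averages, under the outer power. For
    \<open>p = \<infinity>\<close>, \<open>q\<close> and \<open>1 / q\<close> are 0 by convention,
    and \<open>K\<close> is 2.\<close>
  define K where "K = 2 * 2 powr (1 / q)"
  fix n and f g :: "'a \<Rightarrow> complex"
  assume fin: "finite (level adj r n)"
  define h where "h v = complex_of_real (max (cmod (f v)) (cmod (g v)))" for v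
  have le: "cmod ((f + g) v) \<le> 2 * cmod (h v)" for v
    using norm_triangle_ineq[of "f v" "g v"] by (simp add: h_def)
  have fg: "ennreal (Mean adj r p n (f + g)) \<le> ennreal 2 * ennreal (Mean adj r p n h)"
    using fin assms le by (intro Mean_mono) auto
  have hle: "ennreal (Mean adj r p n h)
      \<le> ennreal (2 powr (1 / q)) * (ennreal (Mean adj r p n f) + ennreal (Mean adj r p n g))"
  proof (cases "p = \<infinity>")
    case True
    have "Mean adj r p n h \<le> max (Mean adj r p n f) (Mean adj r p n g)"
    proof (cases "level adj r n = {}")
      case False
      have "cmod (h v) \<le> max (Mean adj r p n f) (Mean adj r p n g)" if "v \<in> level adj r n" for v
      proof -
        have "cmod (k v) \<le> Mean adj r p n k" for k :: "'a \<Rightarrow> complex"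
          using True fin that by (auto simp: Mean_def)
        from this[of f] this[of g] show ?thesis by (auto simp: h_def max_def)
      qed
      then show ?thesis
        using True False fin by (subst (1) Mean_def) auto
    qed (simp add: Mean_def True)
    then have "ennreal (Mean adj r p n h) \<le> ennreal (max (Mean adj r p n f) (Mean adj r p n g))"
      by (rule ennreal_leI)
    \<comment> \<open>In \<open>ennreal\<close> both summands are nonnegative, even if a mean is the
      unspecified \<open>Max {}\<close>.\<close>
    also have "\<dots> \<le> ennreal (Mean adj r p n f) + ennreal (Mean adj r p n g)"
      by (simp add: max_def add_increasing add_increasing2)
    finally show ?thesis using True by (simp add: q_def)
  next
    case False
    have q: "0 < q"
      using assms False by (simp add: q_def enn2real_positive_iff top.not_eq_extremum)
    define A where "A k = 1 / real (card (level adj r n)) * (\<Sum>v\<in>level adj r n. cmod (k v) powr q)"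
      for k :: "'a \<Rightarrow> complex"
    have A0: "0 \<le> A k" for k by (simp add: A_def sum_nonneg)
    have M: "Mean adj r p n k = A k powr (1 / q)" for k
      using False by (simp add: Mean_def A_def q_def)
    have "A h \<le> 1 / real (card (level adj r n)) *
        (\<Sum>v\<in>level adj r n. cmod (f v) powr q + cmod (g v) powr q)"
      unfolding A_def by (intro mult_left_mono sum_mono) (auto simp: h_def max_def)
    also have "\<dots> = A f + A g"
      by (simp add: A_def sum.distrib distrib_left add_divide_distrib)
    \<comment> \<open>The power \<open>1 / q\<close> is not subadditive for \<open>q < 1\<close>,
      whereas the power of a maximum is one of the two powers.\<close>
    also have "\<dots> \<le> 2 * max (A f) (A g)" by simp
    finally have "A h powr (1 / q) \<le> (2 * max (A f) (A g)) powr (1 / q)"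
      using q A0 by (intro powr_mono2) auto
    also have "\<dots> = 2 powr (1 / q) * max (A f) (A g) powr (1 / q)"
      using A0[of f] by (intro powr_mult)
    also have "\<dots> \<le> 2 powr (1 / q) * (A f powr (1 / q) + A g powr (1 / q))"
      by (intro mult_left_mono) (auto simp: max_def)
    finally show ?thesis
      by (simp add: M ennreal_leI flip: ennreal_mult' ennreal_plus)
  qed
  have "ennreal (Mean adj r p n (f + g)) \<le> ennreal 2 * (ennreal (2 powr (1 / q)) *
      (ennreal (Mean adj r p n f) + ennreal (Mean adj r p n g)))"
    using fg mult_left_mono[OF hle] by (rule order_trans) simp
  also have "\<dots> = ennreal K * (ennreal (Mean adj r p n f) + ennreal (Mean adj r p n g))"
    unfolding K_def by (subst ennreal_mult') (auto simp: mult.assoc)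
  finally show "ennreal (Mean adj r p n (f + g))
      \<le> ennreal K * (ennreal (Mean adj r p n f) + ennreal (Mean adj r p n g))" .
qed

text \<open>A single term is at most the whole sum of powers, which is the cardinality of the level
  times the average; the outer power gives the factor.\<close>

lemma cmod_le_Mean:
  assumes "finite (level adj r n)" and "0 < p" and "v \<in> level adj r n"
  shows "cmod (f v) \<le> real (card (level adj r n)) powr (1 / enn2real p) * Mean adj r p n f"
proof (cases "p = \<infinity>")
  case True
  then have "cmod (f v) \<le> Mean adj r p n f"
    using assms by (auto simp: Mean_def)
  \<comment> \<open>The exponent \<open>1 / enn2real p\<close> is 0 here, and
    \<open>0 powr 0\<close> is 0, so the factor equals 1 only because the level is nonempty.\<close>
  moreover have "0 < card (level adj r n)"
    using assms by (auto simp: card_gt_0_iff)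
  ultimately show ?thesis using True by simp
next
  case False
  define q where "q = enn2real p"
  have q: "0 < q"
    using assms False by (simp add: q_def enn2real_positive_iff top.not_eq_extremum)
  define c where "c = real (card (level adj r n))"
  define S where "S = (\<Sum>v\<in>level adj r n. cmod (f v) powr q)"
  have c: "0 < c"
    using assms by (auto simp: c_def card_gt_0_iff)
  have "cmod (f v) powr q \<le> S"
    unfolding S_def using assms by (intro member_le_sum) auto
  then have "(cmod (f v) powr q) powr (1 / q) \<le> (c * (1 / c * S)) powr (1 / q)"
    using q c by (intro powr_mono2) auto
  also have "\<dots> = c powr (1 / q) * (1 / c * S) powr (1 / q)"
    using c by (intro powr_mult)
  finally show ?thesis
    using q False by (simp add: powr_powr Mean_def q_def c_def S_def)
qed

lemma Mean_le_Tnorm: "ennreal (Mean adj r p n f) \<le> Tnorm adj r p f"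
  unfolding Tnorm_def by (rule SUP_upper) simp

lemma Tspace_zero: "0 \<in> Tspace adj r p"
proof -
  \<comment> \<open>The mean of the zero function is 0, except that an empty level gives
    \<open>Max {}\<close> for \<open>p = \<infinity>\<close>; any bound uniform in \<open>n\<close>
    suffices.\<close>
  have "Mean adj r p n 0 \<le> max 0 (Max {})" for n
  proof (cases "p = \<infinity>")
    case True
    show ?thesis
    proof (cases "level adj r n = {}")
      case False
      then have "(\<lambda>v. cmod ((0 :: 'a \<Rightarrow> complex) v)) ` level adj r n = {0}" by auto
      then show ?thesis using True by (simp add: Mean_def)
    qed (simp add: Mean_def True)
  qed (simp add: Mean_def)
  then have "Tnorm adj r p 0 \<le> ennreal (max 0 (Max {}))"
    unfolding Tnorm_def by (intro SUP_least ennreal_leI)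
  then show ?thesis
    unfolding Tspace_def using le_less_trans by fastforce
qed

lemma Tspace_add:
  assumes fin: "\<And>n. finite (level adj r n)" and "0 < p"
    and "f \<in> Tspace adj r p" and "g \<in> Tspace adj r p"
  shows "f + g \<in> Tspace adj r p"
proof -
  obtain K where K: "\<And>n f g. finite (level adj r n) \<Longrightarrow> ennreal (Mean adj r p n (f + g))
      \<le> ennreal K * (ennreal (Mean adj r p n f) + ennreal (Mean adj r p n g))"
    using Mean_quasi_triangle[OF \<open>0 < p\<close>, of adj r] by metis
  have "Tnorm adj r p (f + g) \<le> ennreal K * (Tnorm adj r p f + Tnorm adj r p g)"
    unfolding Tnorm_def[of _ _ _ "f + g"]
    by (intro SUP_least order_trans[OF K[OF fin]] mult_left_mono add_mono Mean_le_Tnorm) simp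
  also have "\<dots> < \<infinity>"
    using assms by (simp add: Tspace_def ennreal_mult_less_top)
  finally show ?thesis by (simp add: Tspace_def)
qed

lemma Tspace_scale:
  assumes fin: "\<And>n. finite (level adj r n)" and "0 < p" and "f \<in> Tspace adj r p"
  shows "(\<lambda>v. c * f v) \<in> Tspace adj r p"
proof -
  \<comment> \<open>The maximum with 1 meets the requirement \<open>1 \<le> K\<close> of
    \<open>Mean_mono\<close>.\<close>
  have "ennreal (Mean adj r p n (\<lambda>v. c * f v)) \<le> ennreal (max 1 (cmod c)) * ennreal (Mean adj r p n f)"
    for n
    using fin assms by (intro Mean_mono) (auto simp: norm_mult intro: mult_right_mono)
  then have "Tnorm adj r p (\<lambda>v. c * f v) \<le> ennreal (max 1 (cmod c)) * Tnorm adj r p f"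
    unfolding Tnorm_def[of _ _ _ "\<lambda>v. c * f v"]
    by (intro SUP_least) (meson Mean_le_Tnorm mult_left_mono order_trans zero_le)
  also have "\<dots> < \<infinity>"
    using assms by (simp add: Tspace_def ennreal_mult_less_top)
  finally show ?thesis by (simp add: Tspace_def)
qed

lemma Tnorm_tendsto_pointwise:
  assumes fin: "\<And>n. finite (level adj r n)" and "0 < p"
    and lim: "(\<lambda>k. Tnorm adj r p (F k - f)) \<longlonglongrightarrow> 0"
  shows "(\<lambda>k. F k v) \<longlonglongrightarrow> f v"
proof -
  define n where "n = depth adj r v"
  \<comment> \<open>This factor depends on the level of \<open>v\<close> but not on
    \<open>k\<close>; being finite, it preserves the limit 0 of the norms.\<close>
  define C where "C = real (card (level adj r n)) powr (1 / enn2real p)"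
  have "C \<ge> 0" by (simp add: C_def)
  have le: "ennreal (cmod (F k v - f v)) \<le> ennreal C * Tnorm adj r p (F k - f)" for k
  proof -
    have "cmod ((F k - f) v) \<le> C * Mean adj r p n (F k - f)"
      unfolding C_def using fin \<open>0 < p\<close> by (intro cmod_le_Mean) (auto simp: level_def n_def)
    then have "ennreal (cmod (F k v - f v)) \<le> ennreal C * ennreal (Mean adj r p n (F k - f))"
      using \<open>C \<ge> 0\<close> by (simp add: ennreal_leI flip: ennreal_mult')
    also have "\<dots> \<le> ennreal C * Tnorm adj r p (F k - f)"
      by (intro mult_left_mono Mean_le_Tnorm) simp
    finally show ?thesis .
  qed
  have "(\<lambda>k. ennreal C * Tnorm adj r p (F k - f)) \<longlonglongrightarrow> ennreal C * 0"
    by (rule tendsto_mult_ennreal) (use lim in auto)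
  then have "(\<lambda>k. ennreal C * Tnorm adj r p (F k - f)) \<longlonglongrightarrow> 0" by simp
  then have "(\<lambda>k. ennreal (cmod (F k v - f v))) \<longlonglongrightarrow> 0"
    by (rule tendsto_sandwich[OF _ _ tendsto_const, rotated 2]) (auto simp: le)
  then have "(\<lambda>k. cmod (F k v - f v)) \<longlonglongrightarrow> 0"
    by (simp add: tendsto_ennreal_iff flip: ennreal_0)
  then show ?thesis
    by (rule LIM_zero_cancel[OF tendsto_norm_zero_cancel])
qed

lemma closed_subspace_vanishing:
  assumes fin: "\<And>n. finite (level adj r n)" and p: "0 < p"
  shows "closed_subspace adj r p {f \<in> Tspace adj r p. \<forall>v\<in>E. f v = 0}"
  unfolding closed_subspace_def
proof (intro conjI)
  show "cfun.subspace {f \<in> Tspace adj r p. \<forall>v\<in>E. f v = 0}"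
    unfolding cfun.subspace_def
    using Tspace_zero Tspace_add[OF fin p] Tspace_scale[OF fin p] by auto
  show "closed_in_Tspace adj r p {f \<in> Tspace adj r p. \<forall>v\<in>E. f v = 0}"
    unfolding closed_in_Tspace_def
  proof (intro allI impI, elim conjE)
    fix F f
    assume F: "\<forall>k. F k \<in> {f \<in> Tspace adj r p. \<forall>v\<in>E. f v = 0}" and f: "f \<in> Tspace adj r p"
      and lim: "(\<lambda>k. Tnorm adj r p (F k - f)) \<longlonglongrightarrow> 0"
    have "f v = 0" if "v \<in> E" for v
    proof -
      \<comment> \<open>The values at \<open>v\<close> form a constant zero sequence, whose limit is
        also \<open>f v\<close>.\<close>
      have "(\<lambda>k. F k v) = (\<lambda>k. 0)" using F that by auto
      then show ?thesis
        using Tnorm_tendsto_pointwise[OF fin p lim, of v] by (simp add: LIMSEQ_const_iff)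
    qed
    with f show "f \<in> {f \<in> Tspace adj r p. \<forall>v\<in>E. f v = 0}" by simp
  qed
qed auto

theorem theorem16:
  fixes adj :: "'v \<Rightarrow> 'v \<Rightarrow> bool" and r :: 'v and p :: ennreal
    and \<psi> :: "'v \<Rightarrow> complex" and E :: "'v set"
  assumes "is_tree adj" and "infinite (UNIV :: 'v set)"
    and "\<And>n. finite (level adj r n)"
    and "0 < p"
    and "bounded_op adj r p (mult_op \<psi>)"
    and "E = {v. \<psi> v \<noteq> 1}"
  shows "{f \<in> Tspace adj r p. mult_op \<psi> f = f} = {f \<in> Tspace adj r p. \<forall>v\<in>E. f v = 0}
    \<and> closed_subspace adj r p {f \<in> Tspace adj r p. \<forall>v\<in>E. f v = 0}"
  \<comment> \<open>After this rewriting the two sets are literally the same, so reflexivity settles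
    the equality.\<close>
  unfolding mult_op_fixed_iff assms(6)
  by (intro conjI refl closed_subspace_vanishing assms)

end
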